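(* Let $1\le t\le s$ be integers, let $\Gamma$ be a finite alphabet of size $v$, and let $\phi:\Gamma^s\to\Gamma^s$ be a weakly secure $(t,s,v)$-AONT. Use $\phi$ as a randomized AONT: fix a set of $t$ of the $s$ input positions (the designated inputs), let $\mathcal{X}$ be the random variable on $\Gamma^t$ giving the values of the designated inputs, with an arbitrary probability distribution subject to $\Pr[\mathcal{X}=\mathbf{u}]>0$ for all $\mathbf{u}\in\Gamma^t$, let the remaining $s-t$ inputs be chosen independently and uniformly at random from $\Gamma$ (mutually independent and independent of $\mathcal{X}$), and let $(\mathbf{Y}_1,\dots,\mathbf{Y}_s)=\phi(\mathbf{X}_1,\dots,\mathbf{X}_s)$, where $(\mathbf{X}_1,\dots,\mathbf{X}_s)$ is the resulting input $s$-tuple. Then, for all $\mathcal{Y}\subseteq\{\mathbf{Y}_1,\dots,\mathbf{Y}_s\}$ with $|\mathcal{Y}|=s-t$ (i.e. for every choice of $s-t$ output positions), $$\mathsf{H}(\mathcal{X}\mid\mathcal{Y})=\mathsf{H}(\mathcal{X}).$$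
   Context: $\mathsf{H}$ denotes Shannon entropy. A function $\phi:\Gamma^s\to\Gamma^s$, $|\Gamma|=v$, is a weakly secure $(t,s,v)$-AONT (all-or-nothing transform) if, for a random input $\mathbf{X}=(\mathbf{X}_1,\dots,\mathbf{X}_s)$ on $\Gamma^s$ in which every $s$-tuple has non-zero probability, and output $(\mathbf{Y}_1,\dots,\mathbf{Y}_s)=\phi(\mathbf{X})$, one has: (i) $\mathsf{H}(\mathbf{Y}_1,\dots,\mathbf{Y}_s\mid\mathbf{X}_1,\dots,\mathbf{X}_s)=0$; (ii) $\mathsf{H}(\mathbf{X}_1,\dots,\mathbf{X}_s\mid\mathbf{Y}_1,\dots,\mathbf{Y}_s)=0$ (so $\phi$ is a bijection); (iii) given the values of any $s-t$ outputs, any $t$ inputs take on any possible values with non-zero probability, i.e. $\Pr[(\mathbf{X}_i)_{i\in I}=\mathbf{u}\mid(\mathbf{Y}_j)_{j\in J}=\mathbf{v}]>0$ for all $I,J\subseteq\{1,\dots,s\}$ with $|I|=t$, $|J|=s-t$ and all $\mathbf{u}\in\Gamma^t$, $\mathbf{v}\in\Gamma^{s-t}$. These conditions do not depend on which full-support distribution of $\mathbf{X}$ is chosen. *)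

theory Defs
  imports "HOL-Probability.Probability"
begin

text \<open>The set of \<open>s\<close>-tuples over \<open>\<Gamma>\<close>. For \<open>I \<subseteq> {1..s}\<close>, the subtuple of \<open>x\<close> at the positions in \<open>I\<close>
  is \<^term>\<open>restrict x I\<close>, an element of \<^term>\<open>I \<rightarrow>\<^sub>E \<Gamma>\<close>.\<close>

abbreviation tuples :: "nat \<Rightarrow> 'a set \<Rightarrow> (nat \<Rightarrow> 'a) set" where
  "tuples s \<Gamma> \<equiv> {1..s} \<rightarrow>\<^sub>E \<Gamma>"

text \<open>Shannon entropy of discrete random variables; on \<^locale>\<open>information_space\<close> these are the library's
  \<open>\<H>(X)\<close> and \<open>\<H>(X | Y)\<close>, made available outside the locale and with the base explicit.\<close>

abbreviation shannon_entropy :: "'c measure \<Rightarrow> real \<Rightarrow> ('c \<Rightarrow> 'd) \<Rightarrow> real" where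
  "shannon_entropy M b X \<equiv> prob_space.entropy M b (count_space (X ` space M)) X"

abbreviation shannon_cond_entropy ::
    "'c measure \<Rightarrow> real \<Rightarrow> ('c \<Rightarrow> 'd) \<Rightarrow> ('c \<Rightarrow> 'e) \<Rightarrow> real" where
  "shannon_cond_entropy M b X Y \<equiv>
     prob_space.conditional_entropy M b (count_space (X ` space M)) (count_space (Y ` space M)) X Y"

definition full_support_mass :: "nat \<Rightarrow> 'a set \<Rightarrow> ((nat \<Rightarrow> 'a) \<Rightarrow> real) \<Rightarrow> bool" where
  "full_support_mass s \<Gamma> p \<longleftrightarrow> (\<forall>x \<in> tuples s \<Gamma>. p x > 0) \<and> (\<Sum>x \<in> tuples s \<Gamma>. p x) = 1"

text \<open>The input is the identity random variable on the probability space of \<open>s\<close>-tuples with mass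
  function \<open>p\<close>, the output is \<open>\<phi>\<close>. Whether the conditions hold is independent of the full-support \<open>p\<close>
  (and of the base of the logarithm), so \<open>p\<close> is existentially quantified, which is the weaker form
  when a weakly secure AONT occurs as a hypothesis. A conditional probability given a null event is
  \<open>0\<close>, so the last condition also says that every value of any \<open>s - t\<close> outputs is attained with
  positive probability.\<close>

definition weakly_secure_AONT ::
    "nat \<Rightarrow> nat \<Rightarrow> nat \<Rightarrow> 'a set \<Rightarrow> ((nat \<Rightarrow> 'a) \<Rightarrow> (nat \<Rightarrow> 'a)) \<Rightarrow> bool" where
  "weakly_secure_AONT t s v \<Gamma> \<phi> \<longleftrightarrow>
     finite \<Gamma> \<and> card \<Gamma> = v \<and> \<phi> \<in> tuples s \<Gamma> \<rightarrow> tuples s \<Gamma> \<and>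
     (\<exists>p. full_support_mass s \<Gamma> p \<and>
       (let M = point_measure (tuples s \<Gamma>) (\<lambda>x. ennreal (p x)) in
          shannon_cond_entropy M 2 \<phi> (\<lambda>x. x) = 0 \<and>
          shannon_cond_entropy M 2 (\<lambda>x. x) \<phi> = 0 \<and>
          (\<forall>I J. I \<subseteq> {1..s} \<longrightarrow> J \<subseteq> {1..s} \<longrightarrow> card I = t \<longrightarrow> card J = s - t \<longrightarrow>
             (\<forall>u \<in> I \<rightarrow>\<^sub>E \<Gamma>. \<forall>w \<in> J \<rightarrow>\<^sub>E \<Gamma>.
                \<P>(x in M. restrict x I = u \<bar> restrict (\<phi> x) J = w) > 0))))"

end

theory Submission
  imports Defs
begin

text \<open>
  Fix a value \<open>u\<close> of the designated inputs. Weak security says that, with the designated inputs held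
  at \<open>u\<close>, the chosen \<open>s - t\<close> outputs still attain every one of their \<open>v ^ (s - t)\<close> values. But only
  \<open>s - t\<close> inputs remain free, so there are only \<open>v ^ (s - t)\<close> inputs to attain them with, and each output
  value is attained exactly once (\<open>weakly_secure_AONT_unique_input\<close>): with \<open>u\<close> fixed, the free inputs
  and the chosen outputs are in bijection. Mere positivity of probabilities is thereby turned into an
  exact count. The free inputs being uniform and independent of the designated ones, the pair
  (designated inputs \<open>u\<close>, chosen outputs \<open>w\<close>) has probability \<open>Pr[u] / v ^ (s - t)\<close>, which factorises
  with a second factor free of \<open>u\<close>. Hence the outputs are independent of the designated inputs and
  reveal nothing about them (\<open>cond_entropy_eq_entropy_of_factorisation\<close>).
\<close>

section \<open>Independence and conditional entropy\<close>

text \<open>Summing the factorisation over the values of \<open>X\<close> identifies \<open>q\<close> as the distribution of \<open>Y\<close>, so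
  the joint distribution is the product of the marginals. The mutual information, being the divergence
  between these two, is \<open>0\<close>.\<close>

lemma (in information_space) cond_entropy_eq_entropy_of_factorisation:
  assumes X: "simple_function M X" and Y: "simple_function M Y"
    and factor: "\<And>x y. x \<in> X ` space M \<Longrightarrow> y \<in> Y ` space M \<Longrightarrow>
      \<P>(\<omega> in M. X \<omega> = x \<and> Y \<omega> = y) = \<P>(\<omega> in M. X \<omega> = x) * q y"
  shows "\<H>(X | Y) = \<H>(X)"
proof -
  let ?A = "X ` space M" and ?B = "Y ` space M"
  have fin: "finite ?A" "finite ?B"
    using X Y by (simp_all add: simple_functionD)
  have X_meas[measurable]: "X \<in> measurable M (count_space ?A)"
    and Y_meas[measurable]: "Y \<in> measurable M (count_space ?B)"
    using X Y by (auto simp: simple_function_def measurable_count_space_eq2)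
  have evX: "{\<omega> \<in> space M. X \<omega> = x} \<in> events" for x
    using simple_functionD(2)[OF X, of "{x}"] by (simp add: vimage_def Int_def conj_commute)
  have evY: "{\<omega> \<in> space M. Y \<omega> = y} \<in> events" for y
    using simple_functionD(2)[OF Y, of "{y}"] by (simp add: vimage_def Int_def conj_commute)
  have evXY: "{\<omega> \<in> space M. X \<omega> = x \<and> Y \<omega> = y} \<in> events" for x y
  proof -
    have "{\<omega> \<in> space M. X \<omega> = x \<and> Y \<omega> = y} =
        {\<omega> \<in> space M. X \<omega> = x} \<inter> {\<omega> \<in> space M. Y \<omega> = y}"
      by auto
    then show ?thesis using sets.Int[OF evX evY] by simp
  qed
  have q: "\<P>(\<omega> in M. Y \<omega> = y) = q y" if y: "y \<in> ?B" for y
  proof -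
    have "\<P>(\<omega> in M. Y \<omega> = y) = (\<Sum>x\<in>?A. \<P>(\<omega> in M. X \<omega> = x \<and> Y \<omega> = y))"
      by (subst finite_measure_finite_Union[symmetric])
         (auto intro!: arg_cong[where f = prob] evXY fin simp: disjoint_family_on_def)
    also have "\<dots> = (\<Sum>x\<in>?A. \<P>(\<omega> in M. X \<omega> = x)) * q y"
      by (simp add: factor y sum_distrib_right)
    also have "(\<Sum>x\<in>?A. \<P>(\<omega> in M. X \<omega> = x)) = prob (space M)"
      by (subst finite_measure_finite_Union[symmetric])
         (auto intro!: arg_cong[where f = prob] evX fin simp: disjoint_family_on_def)
    finally show ?thesis by (simp add: prob_space)
  qed
  interpret DX: prob_space "distr M (count_space ?A) X"
    by (rule prob_space_distr) simp
  interpret DY: prob_space "distr M (count_space ?B) Y"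
    by (rule prob_space_distr) simp
  have prod_space: "count_space ?A \<Otimes>\<^sub>M count_space ?B = count_space (?A \<times> ?B)"
    by (simp add: pair_measure_count_space fin)
  have XY_meas: "(\<lambda>\<omega>. (X \<omega>, Y \<omega>)) \<in> measurable M (count_space (?A \<times> ?B))"
    unfolding prod_space[symmetric] by measurable
  let ?P = "distr M (count_space ?A) X \<Otimes>\<^sub>M distr M (count_space ?B) Y"
  let ?Q = "distr M (count_space ?A \<Otimes>\<^sub>M count_space ?B) (\<lambda>\<omega>. (X \<omega>, Y \<omega>))"
  interpret PQ: pair_prob_space "distr M (count_space ?A) X" "distr M (count_space ?B) Y" ..
  have "sets ?P = sets (count_space ?A \<Otimes>\<^sub>M count_space ?B)"
    by (rule sets_pair_measure_cong) simp_all
  also have "\<dots> = Pow (?A \<times> ?B)"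
    unfolding prod_space by simp
  finally have sets_P: "sets ?P = Pow (?A \<times> ?B)" .
  have indep: "?P = ?Q"
  proof (rule measure_eqI_finite[of _ "?A \<times> ?B"])
    show "sets ?P = Pow (?A \<times> ?B)" by (rule sets_P)
    show "sets ?Q = Pow (?A \<times> ?B)" unfolding prod_space by simp
    show "finite (?A \<times> ?B)" using fin by simp
    fix z assume "z \<in> ?A \<times> ?B"
    then obtain x y where z: "z = (x, y)" and xy: "x \<in> ?A" "y \<in> ?B" by blast
    have "emeasure ?P {z} = emeasure ?P ({x} \<times> {y})" by (simp add: z)
    also have "\<dots> = emeasure (distr M (count_space ?A) X) {x} *
        emeasure (distr M (count_space ?B) Y) {y}"
      using xy by (subst DY.emeasure_pair_measure_Times) auto
    also have "\<dots> = ennreal (\<P>(\<omega> in M. X \<omega> = x) * \<P>(\<omega> in M. Y \<omega> = y))"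
      using xy by (simp add: emeasure_distr emeasure_eq_measure ennreal_mult
          vimage_def Int_def conj_commute)
    also have "\<dots> = ennreal (\<P>(\<omega> in M. X \<omega> = x \<and> Y \<omega> = y))"
      using xy by (simp add: factor q)
    also have "\<dots> = emeasure ?Q {z}"
      unfolding prod_space using xy
      by (subst emeasure_distr[OF XY_meas])
        (auto simp: z emeasure_eq_measure intro!: arg_cong[where f = prob])
    finally show "emeasure ?P {z} = emeasure ?Q {z}" .
  qed
  have "\<I>(X ; Y) = 0"
    using PQ.KL_same_eq_0 indep by (simp add: mutual_information_def)
  then show ?thesis
    using mutual_information_eq_entropy_conditional_entropy[OF X Y] by simp
qed

section \<open>Counting the inputs behind a partial output\<close>

lemma restrict_in_PiE_subset:
  assumes "x \<in> A \<rightarrow>\<^sub>E B" and "I \<subseteq> A"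
  shows "restrict x I \<in> I \<rightarrow>\<^sub>E B"
  using assms by (auto simp: restrict_PiE_iff PiE_iff)

text \<open>Existence is weak security; uniqueness is a count. Inputs with designated part \<open>u\<close> are
  determined by their other \<open>s - t\<close> entries, so there are at most \<open>v ^ (s - t)\<close> of them, and they
  map onto the \<open>v ^ (s - t)\<close> values of the chosen outputs; such a map is injective.\<close>

lemma weakly_secure_AONT_unique_input:
  fixes \<phi> :: "(nat \<Rightarrow> 'a) \<Rightarrow> nat \<Rightarrow> 'a"
  assumes AONT: "weakly_secure_AONT t s v \<Gamma> \<phi>"
    and I: "I \<subseteq> {1..s}" "card I = t" and J: "J \<subseteq> {1..s}" "card J = s - t"
    and u: "u \<in> I \<rightarrow>\<^sub>E \<Gamma>" and w: "w \<in> J \<rightarrow>\<^sub>E \<Gamma>"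
  shows "\<exists>!x. x \<in> tuples s \<Gamma> \<and> restrict x I = u \<and> restrict (\<phi> x) J = w"
proof -
  define A where "A = {x \<in> tuples s \<Gamma>. restrict x I = u}"
  let ?g = "\<lambda>x. restrict (\<phi> x) J"
  have fin: "finite \<Gamma>" and \<phi>: "\<phi> \<in> tuples s \<Gamma> \<rightarrow> tuples s \<Gamma>"
    using AONT by (auto simp: weakly_secure_AONT_def)
  have finIJ: "finite I" "finite J"
    using I J finite_subset by blast+
  have ex: "\<exists>x\<in>A. ?g x = w'" if w': "w' \<in> J \<rightarrow>\<^sub>E \<Gamma>" for w'
  proof -
    let ?N = "\<lambda>p. point_measure (tuples s \<Gamma>) (\<lambda>x. ennreal (p x))"
    obtain p where "\<forall>I J. I \<subseteq> {1..s} \<longrightarrow> J \<subseteq> {1..s} \<longrightarrow> card I = t \<longrightarrow> card J = s - t \<longrightarrow>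
        (\<forall>u \<in> I \<rightarrow>\<^sub>E \<Gamma>. \<forall>w \<in> J \<rightarrow>\<^sub>E \<Gamma>.
          \<P>(x in ?N p. restrict x I = u \<bar> restrict (\<phi> x) J = w) > 0)"
      using AONT unfolding weakly_secure_AONT_def Let_def by (elim conjE exE) (rule that)
    from this[rule_format, OF I(1) J(1) I(2) J(2) u w']
    have pos: "\<P>(x in ?N p. restrict x I = u \<bar> ?g x = w') > 0" .
    have "{x \<in> tuples s \<Gamma>. restrict x I = u \<and> ?g x = w'} \<noteq> {}"
    proof
      assume empty: "{x \<in> tuples s \<Gamma>. restrict x I = u \<and> ?g x = w'} = {}"
      show False
        using pos
        by (simp only: cond_prob_def space_point_measure empty measure_empty div_0 less_irrefl)
    qed
    then show ?thesis by (auto simp: A_def)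
  qed
  have finA: "finite A"
    unfolding A_def using fin by (simp add: finite_PiE)
  have "inj_on (\<lambda>x. restrict x ({1..s} - I)) A"
  proof (rule inj_onI)
    fix x y assume x: "x \<in> A" and y: "y \<in> A"
      and eq: "restrict x ({1..s} - I) = restrict y ({1..s} - I)"
    have "x i = y i" if "i \<in> {1..s}" for i
    proof (cases "i \<in> I")
      case True
      have "restrict x I = restrict y I" using x y by (simp add: A_def)
      with True show ?thesis by (metis restrict_apply')
    next
      case False
      with that have "i \<in> {1..s} - I" by simp
      then show ?thesis using eq by (metis restrict_apply')
    qed
    moreover have "x \<in> tuples s \<Gamma>" "y \<in> tuples s \<Gamma>" using x y by (simp_all add: A_def)
    ultimately show "x = y" by (metis PiE_ext)
  qed
  moreover have "(\<lambda>x. restrict x ({1..s} - I)) ` A \<subseteq> ({1..s} - I) \<rightarrow>\<^sub>E \<Gamma>"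
    by (auto simp: A_def intro!: restrict_in_PiE_subset[of _ "{1..s}"])
  ultimately have "card A \<le> card (({1..s} - I) \<rightarrow>\<^sub>E \<Gamma>)"
    using fin by (intro card_inj_on_le) (auto intro: finite_PiE)
  also have "\<dots> = card (J \<rightarrow>\<^sub>E \<Gamma>)"
    using I J finIJ by (simp add: card_funcsetE card_Diff_subset)
  also have "J \<rightarrow>\<^sub>E \<Gamma> = ?g ` A"
  proof
    show "J \<rightarrow>\<^sub>E \<Gamma> \<subseteq> ?g ` A" using ex by blast
    show "?g ` A \<subseteq> J \<rightarrow>\<^sub>E \<Gamma>"
    proof (rule image_subsetI)
      fix x assume "x \<in> A"
      then have "\<phi> x \<in> tuples s \<Gamma>" using \<phi> by (auto simp only: A_def)
      then show "?g x \<in> J \<rightarrow>\<^sub>E \<Gamma>" using J(1) by (rule restrict_in_PiE_subset)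
    qed
  qed
  finally have "inj_on ?g A"
    using finA card_image_le[OF finA, of ?g] by (intro eq_card_imp_inj_on) auto
  with ex[OF w] show ?thesis
    by (auto simp: A_def inj_on_def)
qed

section \<open>Random tuples\<close>

lemma (in prob_space) prob_indep_uniform_tuple:
  assumes R: "finite R" and fin: "finite \<Gamma>"
    and X: "\<And>i. i \<in> R \<Longrightarrow> X i \<in> measurable M (count_space \<Gamma>)"
    and unif: "\<And>i. i \<in> R \<Longrightarrow> distr M (count_space \<Gamma>) (X i) = uniform_count_measure \<Gamma>"
    and indep: "indep_vars (\<lambda>_. count_space \<Gamma>) X R"
    and r: "r \<in> R \<rightarrow>\<^sub>E \<Gamma>"
  shows "\<P>(\<omega> in M. (\<lambda>i\<in>R. X i \<omega>) = r) = (1 / real (card \<Gamma>)) ^ card R"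
proof (cases "R = {}")
  \<comment> \<open>An intersection over no indices would be the whole type and not the sample space, so the
    product formula starts at one index; the empty case arises when all inputs are designated.\<close>
  case True
  then show ?thesis using r by (simp add: prob_space restrict_def)
next
  case False
  have single: "prob (X i -` {r i} \<inter> space M) = 1 / real (card \<Gamma>)" if i: "i \<in> R" for i
  proof -
    have "r i \<in> \<Gamma>" using r i by auto
    then have "prob (X i -` {r i} \<inter> space M) = measure (distr M (count_space \<Gamma>) (X i)) {r i}"
      using X[OF i] by (simp add: measure_distr)
    also have "\<dots> = 1 / real (card \<Gamma>)"
      using fin \<open>r i \<in> \<Gamma>\<close> by (simp add: unif[OF i] measure_uniform_count_measure)
    finally show ?thesis .
  qed
  have "(\<lambda>i\<in>R. X i \<omega>) = r \<longleftrightarrow> (\<forall>i\<in>R. X i \<omega> = r i)" for \<omega>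
    using r by (auto simp: fun_eq_iff restrict_def PiE_def extensional_def)
  then have "{\<omega> \<in> space M. (\<lambda>i\<in>R. X i \<omega>) = r} = (\<Inter>i\<in>R. X i -` {r i} \<inter> space M)"
    using False by auto
  also have "prob \<dots> = (\<Prod>i\<in>R. prob (X i -` {r i} \<inter> space M))"
    using indep False R r by (intro indep_varsD_finite) auto
  finally show ?thesis by (simp add: single)
qed

lemma simple_function_tuple:
  assumes K: "finite K" and fin: "finite \<Gamma>"
    and X: "\<And>i. i \<in> K \<Longrightarrow> X i \<in> measurable M (count_space \<Gamma>)"
  shows "simple_function M (\<lambda>\<omega>. \<lambda>i\<in>K. X i \<omega>)"
  unfolding simple_function_def
proof (intro conjI ballI)
  let ?Z = "\<lambda>\<omega>. \<lambda>i\<in>K. X i \<omega>"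
  have "?Z ` space M \<subseteq> K \<rightarrow>\<^sub>E \<Gamma>"
    using measurable_space[OF X] by fastforce
  then show "finite (?Z ` space M)"
    by (rule finite_subset) (intro finite_PiE K fin)
  fix z assume "z \<in> ?Z ` space M"
  then have z: "z \<in> K \<rightarrow>\<^sub>E \<Gamma>"
    using \<open>?Z ` space M \<subseteq> K \<rightarrow>\<^sub>E \<Gamma>\<close> by blast
  have "?Z \<omega> = z \<longleftrightarrow> (\<forall>i\<in>K. X i \<omega> = z i)" for \<omega>
    using z by (auto simp: fun_eq_iff restrict_def PiE_def extensional_def)
  then have "?Z -` {z} \<inter> space M = {\<omega> \<in> space M. \<forall>i\<in>K. X i \<omega> = z i}"
    by auto
  also have "\<dots> \<in> sets M"
  proof (rule sets.sets_Collect_finite_All[OF _ K])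
    fix i assume i: "i \<in> K"
    then have "X i -` {z i} \<inter> space M \<in> sets M"
      using z by (intro measurable_sets[OF X]) auto
    then show "{\<omega> \<in> space M. X i \<omega> = z i} \<in> sets M"
      by (simp add: vimage_def Int_def conj_commute)
  qed
  finally show "?Z -` {z} \<inter> space M \<in> sets M" .
qed

section \<open>Preservation of the entropy of the designated inputs\<close>

theorem theorem3p1:
  fixes t s v :: nat and \<Gamma> :: "'a set" and \<phi> :: "(nat \<Rightarrow> 'a) \<Rightarrow> (nat \<Rightarrow> 'a)"
    and M :: "'b measure" and b :: real
    and X :: "nat \<Rightarrow> 'b \<Rightarrow> 'a" and D J :: "nat set"
    and XD XR Y YJ :: "'b \<Rightarrow> nat \<Rightarrow> 'a"
  assumes "1 \<le> t" and "t \<le> s"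
    and "weakly_secure_AONT t s v \<Gamma> \<phi>"
    and "prob_space M" and "1 < b"
    and "\<And>i. i \<in> {1..s} \<Longrightarrow> X i \<in> measurable M (count_space \<Gamma>)"
    and "D \<subseteq> {1..s}" and "card D = t"
    and XD_eq: "XD = (\<lambda>\<omega>. \<lambda>i\<in>D. X i \<omega>)"
    and XR_eq: "XR = (\<lambda>\<omega>. \<lambda>i\<in>{1..s} - D. X i \<omega>)"
    and Y_eq: "Y = (\<lambda>\<omega>. \<phi> (\<lambda>i\<in>{1..s}. X i \<omega>))"
    and YJ_eq: "YJ = (\<lambda>\<omega>. restrict (Y \<omega>) J)"
    and "\<And>u. u \<in> D \<rightarrow>\<^sub>E \<Gamma> \<Longrightarrow> \<P>(\<omega> in M. XD \<omega> = u) > 0"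
    and "\<And>i. i \<in> {1..s} - D \<Longrightarrow> distr M (count_space \<Gamma>) (X i) = uniform_count_measure \<Gamma>"
    and "prob_space.indep_vars M (\<lambda>_. count_space \<Gamma>) X ({1..s} - D)"
    and "prob_space.indep_var M (count_space (D \<rightarrow>\<^sub>E \<Gamma>)) XD (count_space (({1..s} - D) \<rightarrow>\<^sub>E \<Gamma>)) XR"
    and "J \<subseteq> {1..s}" and "card J = s - t"
  shows "shannon_cond_entropy M b XD YJ = shannon_entropy M b XD"
proof -
  interpret prob_space M by fact
  interpret information_space M b by standard fact
  let ?R = "{1..s} - D"
  let ?Z = "\<lambda>\<omega>. \<lambda>i\<in>{1..s}. X i \<omega>"
  note X = assms(6) and D = assms(7,8) and J = assms(17,18)
  have fin: "finite \<Gamma>" and v: "card \<Gamma> = v" and \<phi>: "\<phi> \<in> tuples s \<Gamma> \<rightarrow> tuples s \<Gamma>"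
    using assms(3) by (auto simp: weakly_secure_AONT_def)
  have finD: "finite D" using D finite_subset by blast
  have Z: "?Z \<omega> \<in> tuples s \<Gamma>" if "\<omega> \<in> space M" for \<omega>
    using measurable_space[OF X that] by fastforce
  have XD: "XD \<omega> = restrict (?Z \<omega>) D" and XR: "XR \<omega> = restrict (?Z \<omega>) ?R" for \<omega>
    using D(1) by (auto simp: XD_eq XR_eq fun_eq_iff restrict_def)
  have XD_in: "XD \<omega> \<in> D \<rightarrow>\<^sub>E \<Gamma>" and YJ_in: "YJ \<omega> \<in> J \<rightarrow>\<^sub>E \<Gamma>" if "\<omega> \<in> space M" for \<omega>
  proof -
    show "XD \<omega> \<in> D \<rightarrow>\<^sub>E \<Gamma>"
      unfolding XD using Z[OF that] D(1) by (rule restrict_in_PiE_subset)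
    have "\<phi> (?Z \<omega>) \<in> tuples s \<Gamma>" using \<phi> Z[OF that] by blast
    then show "YJ \<omega> \<in> J \<rightarrow>\<^sub>E \<Gamma>"
      unfolding YJ_eq Y_eq using J(1) by (rule restrict_in_PiE_subset)
  qed
  have sf_XD: "simple_function M XD"
    unfolding XD_eq using finD fin X D(1) by (intro simple_function_tuple) auto
  have "simple_function M ?Z"
    using fin X by (intro simple_function_tuple) auto
  then have sf_YJ: "simple_function M YJ"
    unfolding YJ_eq Y_eq by (rule simple_function_compose1)
  have factor: "\<P>(\<omega> in M. XD \<omega> = u \<and> YJ \<omega> = w) = \<P>(\<omega> in M. XD \<omega> = u) * (1 / real v) ^ (s - t)"
    if u: "u \<in> D \<rightarrow>\<^sub>E \<Gamma>" and w: "w \<in> J \<rightarrow>\<^sub>E \<Gamma>" for u w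
  proof -
    from weakly_secure_AONT_unique_input[OF assms(3) D J u w]
    obtain x where x: "x \<in> tuples s \<Gamma>" "restrict x D = u" "restrict (\<phi> x) J = w"
      and uniq: "\<And>y. y \<in> tuples s \<Gamma> \<Longrightarrow> restrict y D = u \<Longrightarrow> restrict (\<phi> y) J = w \<Longrightarrow> y = x"
      by blast
    let ?r = "restrict x ?R"
    have r: "?r \<in> ?R \<rightarrow>\<^sub>E \<Gamma>" using x(1) by (rule restrict_in_PiE_subset) auto
    \<comment> \<open>Given the designated inputs, observing the outputs \<open>w\<close> is the same as the free inputs
      being \<open>?r\<close>, because \<open>x\<close> is the only input compatible with \<open>u\<close> and \<open>w\<close>.\<close>
    have "XD \<omega> = u \<and> YJ \<omega> = w \<longleftrightarrow> XD \<omega> = u \<and> XR \<omega> = ?r" if \<omega>: "\<omega> \<in> space M" for \<omega>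
    proof
      assume eq: "XD \<omega> = u \<and> YJ \<omega> = w"
      have "restrict (?Z \<omega>) D = u" using eq unfolding XD by blast
      moreover have "restrict (\<phi> (?Z \<omega>)) J = w" using eq unfolding YJ_eq Y_eq by blast
      ultimately have "?Z \<omega> = x" by (rule uniq[OF Z[OF \<omega>]])
      then have "XR \<omega> = ?r" by (simp only: XR)
      then show "XD \<omega> = u \<and> XR \<omega> = ?r" using eq by blast
    next
      assume eq: "XD \<omega> = u \<and> XR \<omega> = ?r"
      have "?Z \<omega> i = x i" if "i \<in> {1..s}" for i
      proof (cases "i \<in> D")
        case True
        then show ?thesis using eq x(2) XD by (metis restrict_apply')
      next
        case False
        with that have "i \<in> ?R" by simp
        then show ?thesis using eq XR by (metis restrict_apply')
      qed
      then have "?Z \<omega> = x" using PiE_ext[OF Z[OF \<omega>] x(1)] by blast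
      then have "YJ \<omega> = w" by (simp only: YJ_eq Y_eq x(3))
      then show "XD \<omega> = u \<and> YJ \<omega> = w" using eq by simp
    qed
    then have "\<P>(\<omega> in M. XD \<omega> = u \<and> YJ \<omega> = w) =
        prob ((\<lambda>\<omega>. (XD \<omega>, XR \<omega>)) -` ({u} \<times> {?r}) \<inter> space M)"
      by (intro arg_cong[where f = prob]) auto
    also have "\<dots> = prob (XD -` {u} \<inter> space M) * prob (XR -` {?r} \<inter> space M)"
      using u r by (intro indep_varD[OF assms(16)]) auto
    also have "\<dots> = \<P>(\<omega> in M. XD \<omega> = u) * \<P>(\<omega> in M. XR \<omega> = ?r)"
      by (simp add: vimage_def Int_def conj_commute)
    also have "\<P>(\<omega> in M. XR \<omega> = ?r) = (1 / real (card \<Gamma>)) ^ card ?R"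
      unfolding XR_eq using fin X assms(14,15) r
      by (intro prob_indep_uniform_tuple) auto
    also have "card ?R = s - t"
      using D finD by (simp add: card_Diff_subset)
    finally show ?thesis by (simp add: v)
  qed
  show ?thesis
  proof (rule cond_entropy_eq_entropy_of_factorisation[OF sf_XD sf_YJ])
    fix u w assume "u \<in> XD ` space M" and "w \<in> YJ ` space M"
    then have "u \<in> D \<rightarrow>\<^sub>E \<Gamma>" and "w \<in> J \<rightarrow>\<^sub>E \<Gamma>"
      using XD_in YJ_in by blast+
    then show "\<P>(\<omega> in M. XD \<omega> = u \<and> YJ \<omega> = w) =
        \<P>(\<omega> in M. XD \<omega> = u) * (1 / real v) ^ (s - t)"
      by (rule factor)
  qed
qed

end
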